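(* For every integer $k\ge 1$, $2\le \chi_{la}(B_k)\le 3$.
   Context: For a graph $G=(V,E)$ with $|E|=m$ and no isolated vertices, a local antimagic labeling is a bijection $f:E\to\{1,\dots,m\}$ such that $f^+(u)\ne f^+(v)$ for every edge $uv$, where $f^+(x)=\sum f(e)$ over all edges $e$ incident to $x$. The local antimagic chromatic number $\chi_{la}(G)$ is the minimum, over all local antimagic labelings $f$ of $G$, of the number of distinct values taken by $f^+$ (also for disconnected graphs). Let $C_8^*$ be the graph consisting of an 8-cycle $u_1u_2\cdots u_8u_1$ together with an additional vertex $x$ adjacent to $u_2$ and $u_6$. Let $B_8$ be the graph obtained from $C_8^*$ by identifying (merging) the vertices $u_4$ and $u_8$ into a single vertex. $B_k$ is the disjoint union of $k$ copies of $B_8$. *)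

theory Defs
  imports Main
begin

record 'a graph =
  verts :: "'a set"
  edges :: "'a set set"

definition simple_graph :: "'a graph \<Rightarrow> bool" where
  "simple_graph G \<longleftrightarrow> finite (verts G) \<and> edges G \<subseteq> {e. e \<subseteq> verts G \<and> card e = 2}"

definition no_isolated_vertices :: "'a graph \<Rightarrow> bool" where
  "no_isolated_vertices G \<longleftrightarrow> (\<forall>v \<in> verts G. \<exists>e \<in> edges G. v \<in> e)"

definition induced_label :: "'a graph \<Rightarrow> ('a set \<Rightarrow> nat) \<Rightarrow> 'a \<Rightarrow> nat" where
  "induced_label G f v = (\<Sum>e \<in> {e \<in> edges G. v \<in> e}. f e)"

definition local_antimagic :: "'a graph \<Rightarrow> ('a set \<Rightarrow> nat) \<Rightarrow> bool" where
  "local_antimagic G f \<longleftrightarrow>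
     bij_betw f (edges G) {1..card (edges G)} \<and>
     (\<forall>u v. {u, v} \<in> edges G \<longrightarrow> induced_label G f u \<noteq> induced_label G f v)"

text \<open>
  The infimum of a nonempty set of natural numbers is its minimum. Over the empty set it is 0,
  so a positive lower bound on \<open>chi_la G\<close> entails that \<open>G\<close> has a local antimagic labeling.
\<close>

definition chi_la :: "'a graph \<Rightarrow> nat" where
  "chi_la G = Inf {card (induced_label G f ` verts G) | f. local_antimagic G f}"

text \<open>
  Merging \<open>b\<close> into \<open>a\<close>. Loops and parallel edges would be lost or turned into singletons; for the
  graph \<open>B8\<close> below this does not occur (see \<open>edges_B8\<close>, \<open>card_edges_B8\<close> and \<open>simple_graph_B8\<close>).
\<close>

definition identify :: "'a \<Rightarrow> 'a \<Rightarrow> 'a graph \<Rightarrow> 'a graph" where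
  "identify a b G =
     (let q = (\<lambda>v. if v = b then a else v)
      in \<lparr>verts = q ` verts G, edges = (`) q ` edges G\<rparr>)"

definition copies :: "nat \<Rightarrow> 'a graph \<Rightarrow> (nat \<times> 'a) graph" where
  "copies k G =
     \<lparr>verts = {..<k} \<times> verts G,
      edges = {Pair i ` e | i e. i < k \<and> e \<in> edges G}\<rparr>"

datatype vertex = U nat | X

definition C8_star :: "vertex graph" where
  "C8_star =
     \<lparr>verts = U ` {1..8} \<union> {X},
      edges = (\<lambda>i. {U i, U (i + 1)}) ` {1..7} \<union> {{U 8, U 1}, {X, U 2}, {X, U 6}}\<rparr>"

definition B8 :: "vertex graph" where
  "B8 = identify (U 4) (U 8) C8_star"

definition B :: "nat \<Rightarrow> (nat \<times> vertex) graph" where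
  "B k = copies k B8"

lemma verts_B8: "verts B8 = {U 1, U 2, U 3, U 4, U 5, U 6, U 7, X}"
proof -
  have "{1..8::nat} = {1, 2, 3, 4, 5, 6, 7, 8}" by auto
  then show ?thesis by (auto simp: B8_def identify_def C8_star_def)
qed

lemma edges_B8:
  "edges B8 =
     {{U 1, U 2}, {U 2, U 3}, {U 3, U 4}, {U 4, U 5}, {U 5, U 6}, {U 6, U 7},
      {U 7, U 4}, {U 4, U 1}, {X, U 2}, {X, U 6}}"
proof -
  have "{1..7::nat} = {1, 2, 3, 4, 5, 6, 7}" by auto
  then show ?thesis
    unfolding B8_def identify_def C8_star_def Let_def graph.simps by (simp add: insert_commute flip: numeral_2_eq_2)
qed

lemma card_edges_B8: "card (edges B8) = 10"
  by (simp add: edges_B8 doubleton_eq_iff)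

lemma simple_graph_B8: "simple_graph B8"
  by (simp add: simple_graph_def verts_B8 edges_B8)

lemma simple_graph_B: "simple_graph (B k)"
proof -
  have card_Pair: "card (Pair i ` e) = card e" for i :: nat and e :: "vertex set"
    by (intro card_image) (auto simp: inj_on_def)
  have fin: "finite (verts B8)" and sub: "\<And>e. e \<in> edges B8 \<Longrightarrow> e \<subseteq> verts B8 \<and> card e = 2"
    using simple_graph_B8 by (auto simp only: simple_graph_def)
  have "e' \<subseteq> verts (B k) \<and> card e' = 2" if "e' \<in> edges (B k)" for e'
  proof -
    from that obtain i e where ie: "e' = Pair i ` e" "i < k" "e \<in> edges B8"
      unfolding B_def copies_def graph.simps by blast
    then show ?thesis
      using sub[OF ie(3)] unfolding B_def copies_def graph.simps by (auto simp: card_Pair)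
  qed
  moreover have "finite (verts (B k))"
    using fin unfolding B_def copies_def graph.simps by simp
  ultimately show ?thesis
    unfolding simple_graph_def by blast
qed

lemma no_isolated_vertices_B: "no_isolated_vertices (B k)"
  unfolding no_isolated_vertices_def
proof
  fix v assume "v \<in> verts (B k)"
  then obtain i w where iw: "v = (i, w)" "i < k" "w \<in> verts B8"
    unfolding B_def copies_def graph.simps by blast
  from iw(3) have "\<exists>e \<in> edges B8. w \<in> e"
    unfolding verts_B8 edges_B8 by auto
  then obtain e where "e \<in> edges B8" "w \<in> e" by blast
  then have "Pair i ` e \<in> edges (B k)" "v \<in> Pair i ` e"
    using iw unfolding B_def copies_def graph.simps by blast+
  then show "\<exists>e \<in> edges (B k). v \<in> e" by blast
qed

end

theory Submission
  imports Defs
begin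

text \<open>
  \<open>B8\<close> is bipartite with parts \<open>{U 2, U 4, U 6}\<close> and \<open>{U 1, U 3, U 5, U 7, X}\<close>, where all vertices
  of the second part have degree two. We label so that the two edges at such a vertex are
  complementary, with sum \<open>M = 10 * k + 1\<close>, and so that in every copy \<open>U 2\<close> and \<open>U 6\<close> receive
  the same colour \<open>A\<close>. Then \<open>U 4\<close> receives \<open>5 * M - 2 * A\<close>, so three colours suffice. Labels with
  these properties can be chosen as arithmetic progressions in the index of the copy, separately
  on two halves of the copies.
\<close>

section \<open>Indexing the edges of the copies\<close>

definition B8_edge_list :: "vertex set list" where
  "B8_edge_list =
     [{U 1, U 2}, {U 2, U 3}, {U 3, U 4}, {U 4, U 5}, {U 5, U 6}, {U 6, U 7},
      {U 7, U 4}, {U 4, U 1}, {X, U 2}, {X, U 6}]"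

text \<open>Fixing an order of the edges turns a labeling of \<open>k\<close> copies into a
  \<open>k\<close> by 10 table \<open>p i j\<close>. In this order the degree-two vertices own the
  index pairs (0,7), (1,2), (3,4), (5,6) and (8,9).\<close>

lemma bij_betw_B8_edge_list: "bij_betw ((!) B8_edge_list) {..<10} (edges B8)"
proof (rule bij_betw_nth)
  show "distinct B8_edge_list"
    by (simp add: B8_edge_list_def doubleton_eq_iff)
qed (simp_all add: B8_edge_list_def edges_B8)

lemma inj_Pair_image: "inj ((`) (Pair i))"
  by (simp add: inj_def inj_image_eq_iff)

text \<open>All edges at \<open>(i, v)\<close> lie in copy \<open>i\<close>, so colours can be
  computed inside a single \<open>B8\<close>.\<close>

lemma induced_label_copies:
  assumes "i < k"
  shows "induced_label (copies k G) f (i, v) = induced_label G (\<lambda>e. f (Pair i ` e)) v"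
proof -
  have "{e \<in> edges (copies k G). (i, v) \<in> e} = (`) (Pair i) ` {e \<in> edges G. v \<in> e}"
    using assms by (auto simp: copies_def)
  then show ?thesis
    unfolding induced_label_def
    by (simp add: sum.reindex inj_on_subset[OF inj_Pair_image])
qed

lemma induced_label_B8:
  "induced_label B8 g v = (\<Sum>j<10. if v \<in> B8_edge_list ! j then g (B8_edge_list ! j) else 0)"
proof -
  have "finite (edges B8)"
    by (simp add: edges_B8)
  then have "induced_label B8 g v = (\<Sum>e\<in>edges B8. if v \<in> e then g e else 0)"
    by (simp add: induced_label_def sum.inter_filter)
  also have "\<dots> = (\<Sum>j<10. if v \<in> B8_edge_list ! j then g (B8_edge_list ! j) else 0)"
    by (rule sum.reindex_bij_betw[OF bij_betw_B8_edge_list, symmetric])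
  finally show ?thesis .
qed

lemma edges_B:
  "edges (B k) = (\<lambda>(i, j). Pair i ` (B8_edge_list ! j)) ` ({..<k} \<times> {..<10})"
  unfolding B_def copies_def bij_betw_imp_surj_on[OF bij_betw_B8_edge_list, symmetric] by auto

lemma inj_on_B_edges: "inj_on (\<lambda>(i, j). Pair i ` (B8_edge_list ! j)) ({..<k} \<times> {..<10})"
proof (rule inj_onI, clarify)
  fix i j i' j'
  assume j: "j < (10::nat)" "j' < 10"
    and eq: "Pair i ` (B8_edge_list ! j) = Pair i' ` (B8_edge_list ! j')"
  \<comment> \<open>An endpoint is needed to read off the copy: an empty edge would have the same
    image in every copy.\<close>
  have ne: "B8_edge_list ! j \<noteq> {}" if "j < 10" for j
    using bij_betw_apply[OF bij_betw_B8_edge_list, of j] that by (auto simp: edges_B8)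
  obtain v where "v \<in> B8_edge_list ! j"
    using ne j by blast
  then have "(i, v) \<in> Pair i' ` (B8_edge_list ! j')"
    by (simp flip: eq)
  then have "i = i'" by auto
  with eq have "B8_edge_list ! j = B8_edge_list ! j'"
    by (metis inj_Pair_image injD)
  then have "j = j'"
    using bij_betw_imp_inj_on[OF bij_betw_B8_edge_list] j by (auto dest: inj_onD)
  with \<open>i = i'\<close> show "i = i' \<and> j = j'" by simp
qed

lemma card_edges_B: "card (edges (B k)) = 10 * k"
  by (simp add: edges_B card_image[OF inj_on_B_edges])

lemma sum_lessThan_10:
  fixes F :: "nat \<Rightarrow> nat"
  shows "(\<Sum>j<10. F j) = F 0 + F 1 + F 2 + F 3 + F 4 + F 5 + F 6 + F 7 + F 8 + F 9"
  by (simp add: eval_nat_numeral)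

section \<open>From a table of labels to a local antimagic labeling\<close>

text \<open>Reduces the construction to linear identities on a table. Covering the lower half of the
  labels is enough, because complements within the same copy supply the upper half.\<close>

lemma B_labeling_exists:
  fixes p :: "nat \<Rightarrow> nat \<Rightarrow> nat"
  assumes cover: "\<And>x. \<lbrakk>1 \<le> x; x \<le> 5 * k\<rbrakk> \<Longrightarrow> \<exists>i<k. \<exists>j<10. p i j = x"
    and U1: "\<And>i. i < k \<Longrightarrow> p i 0 + p i 7 = 10 * k + 1"
    and U3: "\<And>i. i < k \<Longrightarrow> p i 1 + p i 2 = 10 * k + 1"
    and U5: "\<And>i. i < k \<Longrightarrow> p i 3 + p i 4 = 10 * k + 1"
    and U7: "\<And>i. i < k \<Longrightarrow> p i 5 + p i 6 = 10 * k + 1"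
    and X: "\<And>i. i < k \<Longrightarrow> p i 8 + p i 9 = 10 * k + 1"
    and U2: "\<And>i. i < k \<Longrightarrow> p i 0 + p i 1 + p i 8 = A"
    and U6: "\<And>i. i < k \<Longrightarrow> p i 4 + p i 5 + p i 9 = A"
    and U4: "\<And>i. i < k \<Longrightarrow> p i 2 + p i 3 + p i 6 + p i 7 = C"
    and ne: "A \<noteq> 10 * k + 1" "C \<noteq> 10 * k + 1"
  shows "\<exists>f. local_antimagic (B k) f \<and> card (induced_label (B k) f ` verts (B k)) \<le> 3"
proof -
  let ?I = "{..<k} \<times> {..<10::nat}"
  let ?e = "\<lambda>(i, j). Pair i ` (B8_edge_list ! j)"
  define f where "f = case_prod p \<circ> inv_into ?I ?e"
  have f: "f (Pair i ` (B8_edge_list ! j)) = p i j" if "i < k" "j < 10" for i j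
    using inv_into_f_f[OF inj_on_B_edges, of "(i, j)" k] that by (simp add: f_def)
  have partner: "\<exists>j'<10. p i j + p i j' = 10 * k + 1" if "i < k" "j < 10" for i j
  proof -
    have "j \<in> {0, 1, 2, 3, 4, 5, 6, 7, 8, 9}"
      using that(2) by auto
    then show ?thesis
      using U1[OF that(1)] U3[OF that(1)] U5[OF that(1)] U7[OF that(1)] X[OF that(1)]
      \<comment> \<open>All ten indices are offered as partner; backtracking keeps the one for which
        simplification closes the goal.\<close>
      by (elim insertE emptyE)
        (rule exI[of _ 7] exI[of _ 2] exI[of _ 1] exI[of _ 4] exI[of _ 3] exI[of _ 6]
           exI[of _ 5] exI[of _ 0] exI[of _ 9] exI[of _ 8], simp add: add.commute; fail)+
  qed
  have sub: "{1..10 * k} \<subseteq> f ` edges (B k)"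
  proof
    fix x assume x: "x \<in> {1..10 * k}"
    have "\<exists>i<k. \<exists>j<10. p i j = x"
    proof (cases "x \<le> 5 * k")
      case False
      with x have "1 \<le> 10 * k + 1 - x" "10 * k + 1 - x \<le> 5 * k"
        by auto
      then obtain i j where ij: "i < k" "j < 10" "p i j = 10 * k + 1 - x"
        using cover by blast
      from partner[OF this(1,2)] obtain j' where "j' < 10" "p i j + p i j' = 10 * k + 1"
        by blast
      with ij(1,3) x show ?thesis
        by (intro exI[of _ i] conjI exI[of _ j']) auto
    qed (use x cover in auto)
    then obtain i j where ij: "i < k" "j < 10" "p i j = x"
      by blast
    then have "Pair i ` (B8_edge_list ! j) \<in> edges (B k)"
      by (auto simp: edges_B)
    with f[OF ij(1,2)] ij(3) show "x \<in> f ` edges (B k)"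
      by (intro image_eqI) auto
  qed
  have fin: "finite (edges (B k))"
    by (simp add: edges_B)
  \<comment> \<open>There are exactly \<open>10 * k\<close> edges, so covering all labels leaves no
    room for other values or repetitions.\<close>
  have image: "f ` edges (B k) = {1..10 * k}"
    using card_image_le[OF fin, of f] sub
    by (intro card_seteq[symmetric]) (simp_all add: fin card_edges_B)
  then have "inj_on f (edges (B k))"
    by (intro eq_card_imp_inj_on fin) (simp add: card_edges_B)
  with image have bij: "bij_betw f (edges (B k)) {1..card (edges (B k))}"
    by (simp add: bij_betw_def card_edges_B)
  let ?col = "\<lambda>v. if v = U 2 \<or> v = U 6 then A else if v = U 4 then C else 10 * k + 1"
  have col: "induced_label (B k) f (i, v) = ?col v" if "i < k" "v \<in> verts B8" for i v
  proof -
    have "induced_label (B k) f (i, v) =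
        (\<Sum>j<10. if v \<in> B8_edge_list ! j then f (Pair i ` (B8_edge_list ! j)) else 0)"
      unfolding B_def induced_label_copies[OF that(1)] induced_label_B8 ..
    also have "\<dots> = (\<Sum>j<10. if v \<in> B8_edge_list ! j then p i j else 0)"
      by (intro sum.cong) (simp_all add: f that)
    also have "\<dots> = ?col v"
      using that(2) unfolding verts_B8 sum_lessThan_10
      by (elim insertE emptyE; hypsubst)
        (use that(1) in \<open>simp_all add: B8_edge_list_def U1 U2[simplified] U3[simplified] U4 U5 U6 U7 X\<close>)
    finally show ?thesis .
  qed
  have "induced_label (B k) f u \<noteq> induced_label (B k) f v" if "{u, v} \<in> edges (B k)" for u v
  proof -
    from that obtain i e where i: "i < k" and e: "e \<in> edges B8" "Pair i ` e = {u, v}"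
      by (auto simp: B_def copies_def)
    then obtain a b where ab: "u = (i, a)" "v = (i, b)"
      by (metis imageE insertCI)
    then have "Pair i ` {a, b} = Pair i ` e"
      using e by simp
    then have "{a, b} \<in> edges B8"
      using e(1) inj_Pair_image by (metis injD)
    moreover from this have "a \<in> verts B8" "b \<in> verts B8"
      using simple_graph_B8 by (auto simp: simple_graph_def)
    \<comment> \<open>Every edge joins one of \<open>U 2\<close>, \<open>U 4\<close>,
      \<open>U 6\<close> to a vertex of colour \<open>10 * k + 1\<close>, so the two inequalities in
      \<open>ne\<close> suffice; \<open>A\<close> and \<open>C\<close> never meet on an
      edge.\<close>
    ultimately show ?thesis
      using ne by (auto simp: ab col i edges_B8 doubleton_eq_iff)
  qed
  with bij have "local_antimagic (B k) f"
    by (simp add: local_antimagic_def)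
  moreover have "induced_label (B k) f ` verts (B k) \<subseteq> {10 * k + 1, A, C}"
    using col by (auto simp: B_def copies_def)
  then have "card (induced_label (B k) f ` verts (B k)) \<le> card {10 * k + 1, A, C}"
    by (intro card_mono) auto
  then have "card (induced_label (B k) f ` verts (B k)) \<le> 3"
    by (rule order_trans) (simp add: card_insert_if)
  ultimately show ?thesis by blast
qed

section \<open>Explicit tables for even and odd numbers of copies\<close>

lemma B_even_labeling_exists:
  assumes "h \<ge> 1"
  shows "\<exists>f. local_antimagic (B (2 * h)) f \<and>
    card (induced_label (B (2 * h)) f ` verts (B (2 * h))) \<le> 3"
proof -
  \<comment> \<open>In both rows the slopes in \<open>i\<close> cancel at \<open>U 2\<close>,
    \<open>U 6\<close> and \<open>U 4\<close>. On each half every complementary pair contributes one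
    progression of labels up to \<open>10 * h\<close>. Those of step two interleave: the first half
    takes the even labels, the second the odd ones.\<close>
  define p :: "nat \<Rightarrow> nat \<Rightarrow> nat" where
    "p i = (!) (if i < h
        then [12*h + 1 + i, 2*h - 2*i, 18*h + 1 + 2*i, 12*h - 1 - 2*i, 8*h + 2 + 2*i,
              18*h - i, 2*h + 1 + i, 8*h - i, 16*h + 1 + i, 4*h - i]
        else [8*h + 2 + 2*i, 7*h - i, 13*h + 1 + i, 17*h - i, 3*h + 1 + i,
              22*h - 2*i, 1 + 2*i - 2*h, 12*h - 1 - 2*i, 15*h - i, 5*h + 1 + i])" for i
  show ?thesis
  proof (rule B_labeling_exists[where p = p and A = "30*h + 2" and C = "40*h + 1"])
    fix x :: nat assume x: "1 \<le> x" "x \<le> 5 * (2 * h)"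
    have hit: "\<exists>i<2 * h. \<exists>j<10. p i j = x" if "i < 2 * h" "j < 10" "p i j = x" for i j
      using that by blast
    \<comment> \<open>One case for each of the ten progressions (five pairs, two halves); the
      witness for \<open>i\<close> inverts the progression.\<close>
    consider "x \<le> 2 * h" "even x"
      | "x \<le> 2 * h" "odd x"
      | "2 * h < x" "x \<le> 3 * h"
      | "3 * h < x" "x \<le> 4 * h"
      | "4 * h < x" "x \<le> 5 * h"
      | "5 * h < x" "x \<le> 6 * h"
      | "6 * h < x" "x \<le> 7 * h"
      | "7 * h < x" "x \<le> 8 * h"
      | "8 * h < x" "even x"
      | "8 * h < x" "odd x"
      using x by linarith
    then show "\<exists>i<2 * h. \<exists>j<10. p i j = x"
    proof cases
      case 1
      with x show ?thesis
        by (intro hit[of "h - x div 2" 1]) (auto simp: p_def elim!: evenE oddE)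
    next
      case 2
      with x show ?thesis
        by (intro hit[of "h + x div 2" 6]) (auto simp: p_def elim!: evenE oddE)
    next
      case 3
      with x show ?thesis
        by (intro hit[of "x - 2 * h - 1" 6]) (auto simp: p_def)
    next
      case 4
      with x show ?thesis
        by (intro hit[of "4 * h - x" 9]) (auto simp: p_def)
    next
      case 5
      with x show ?thesis
        by (intro hit[of "x - 3 * h - 1" 4]) (auto simp: p_def)
    next
      case 6
      with x show ?thesis
        by (intro hit[of "7 * h - x" 1]) (auto simp: p_def)
    next
      case 7
      with x show ?thesis
        by (intro hit[of "x - 5 * h - 1" 9]) (auto simp: p_def)
    next
      case 8
      with x show ?thesis
        by (intro hit[of "8 * h - x" 7]) (auto simp: p_def)
    next
      case 9
      with x show ?thesis
        by (intro hit[of "x div 2 - 4 * h - 1" 4]) (auto simp: p_def elim!: evenE oddE)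
    next
      case 10
      with x show ?thesis
        by (intro hit[of "6 * h - 1 - x div 2" 7]) (auto simp: p_def elim!: evenE oddE)
    qed
  \<comment> \<open>For \<open>h = 0\<close> the colour \<open>40*h + 1\<close> would coincide with
    \<open>20*h + 1\<close>.\<close>
  qed (use assms in \<open>simp_all add: p_def\<close>)
qed

lemma B_odd_labeling_exists:
  "\<exists>f. local_antimagic (B (2 * h + 1)) f \<and>
    card (induced_label (B (2 * h + 1)) f ` verts (B (2 * h + 1))) \<le> 3"
proof -
  \<comment> \<open>The halves have \<open>h + 1\<close> and \<open>h\<close> copies. The pairs at
    \<open>U 1\<close> and \<open>U 5\<close> run through all copies as single progressions; those
    at \<open>U 3\<close>, \<open>U 7\<close> and \<open>X\<close> split, so eight progressions
    cover the lower labels.\<close>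
  define p :: "nat \<Rightarrow> nat \<Rightarrow> nat" where
    "p i = (!) (if i \<le> h
        then [16*h + 9 + i, h + 1 + i, 19*h + 10 - i, 4*h + 3 + i, 16*h + 8 - i,
              9*h + 5 - i, 11*h + 6 + i, 4*h + 2 - i, 14*h + 7 - 2*i, 6*h + 4 + 2*i]
        else [16*h + 9 + i, i - h, 21*h + 11 - i, 4*h + 3 + i, 16*h + 8 - i,
              11*h + 6 - i, 9*h + 5 + i, 4*h + 2 - i, 16*h + 8 - 2*i, 4*h + 3 + 2*i])" for i
  show ?thesis
  proof (rule B_labeling_exists[where p = p and A = "31*h + 17" and C = "38*h + 21"])
    fix x :: nat assume x: "1 \<le> x" "x \<le> 5 * (2 * h + 1)"
    have hit: "\<exists>i<2 * h + 1. \<exists>j<10. p i j = x" if "i < 2 * h + 1" "j < 10" "p i j = x" for i j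
      using that by blast
    consider "x \<le> h"
      | "h < x" "x \<le> 2 * h + 1"
      | "2 * h + 1 < x" "x \<le> 4 * h + 2"
      | "4 * h + 2 < x" "x \<le> 6 * h + 3"
      | "6 * h + 3 < x" "x \<le> 8 * h + 4" "even x"
      | "6 * h + 3 < x" "x \<le> 8 * h + 4" "odd x"
      | "8 * h + 4 < x" "x \<le> 9 * h + 5"
      | "9 * h + 5 < x"
      using x by linarith
    then show "\<exists>i<2 * h + 1. \<exists>j<10. p i j = x"
    proof cases
      case 1
      with x show ?thesis
        by (intro hit[of "h + x" 1]) (auto simp: p_def)
    next
      case 2
      with x show ?thesis
        by (intro hit[of "x - h - 1" 1]) (auto simp: p_def)
    next
      case 3
      with x show ?thesis
        by (intro hit[of "4 * h + 2 - x" 7]) (auto simp: p_def)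
    next
      case 4
      with x show ?thesis
        by (intro hit[of "x - 4 * h - 3" 3]) (auto simp: p_def)
    next
      case 5
      with x show ?thesis
        by (intro hit[of "x div 2 - 3 * h - 2" 9]) (auto simp: p_def elim!: evenE oddE)
    next
      case 6
      with x show ?thesis
        by (intro hit[of "x div 2 - 2 * h - 1" 9]) (auto simp: p_def elim!: evenE oddE)
    next
      case 7
      with x show ?thesis
        by (intro hit[of "9 * h + 5 - x" 5]) (auto simp: p_def)
    next
      case 8
      with x show ?thesis
        by (intro hit[of "11 * h + 6 - x" 5]) (auto simp: p_def)
    qed
  qed (simp_all add: p_def)
qed

section \<open>Both bounds on the chromatic number\<close>

theorem theorem4p3:
  fixes k :: nat
  assumes "k \<ge> 1"
  shows "2 \<le> chi_la (B k) \<and> chi_la (B k) \<le> 3"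
proof -
  let ?S = "{card (induced_label (B k) f ` verts (B k)) | f. local_antimagic (B k) f}"
  obtain f where f: "local_antimagic (B k) f" "card (induced_label (B k) f ` verts (B k)) \<le> 3"
  proof (cases "even k")
    case True
    then obtain h where "k = 2 * h" by (elim evenE)
    with assms B_even_labeling_exists[of h] that show ?thesis by auto
  next
    case False
    then obtain h where "k = 2 * h + 1" by (elim oddE)
    with B_odd_labeling_exists[of h] that show ?thesis by auto
  qed
  \<comment> \<open>A single edge, here in copy 0, already forces two colours.\<close>
  have "2 \<le> n" if "n \<in> ?S" for n
  proof -
    from that obtain g where g: "local_antimagic (B k) g"
      and n: "n = card (induced_label (B k) g ` verts (B k))" by blast
    have "{U 1, U 2} \<in> edges B8"
      by (simp add: edges_B8)
    then have "Pair 0 ` {U 1, U 2} \<in> edges (B k)"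
      using assms unfolding B_def copies_def graph.simps by (metis (mono_tags, lifting) less_le_trans mem_Collect_eq zero_less_one)
    then have "{(0, U 1), (0, U 2)} \<in> edges (B k)"
      by simp
    with g have "induced_label (B k) g (0, U 1) \<noteq> induced_label (B k) g (0, U 2)"
      unfolding local_antimagic_def by blast
    then have "2 = card {induced_label (B k) g (0, U 1), induced_label (B k) g (0, U 2)}"
      by simp
    also have "\<dots> \<le> n"
      unfolding n using assms
      by (intro card_mono) (simp_all add: B_def copies_def verts_B8)
    finally show ?thesis .
  qed
  \<comment> \<open>The labeling \<open>f\<close> makes \<open>?S\<close> nonempty, so the infimum
    is attained and is not the default 0.\<close>
  moreover have "chi_la (B k) \<in> ?S"
    unfolding chi_la_def using f(1) by (intro Inf_nat_def1) blast
  moreover have "chi_la (B k) \<le> card (induced_label (B k) f ` verts (B k))"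
    unfolding chi_la_def using f(1) by (intro wellorder_Inf_le1) blast
  ultimately show ?thesis
    using f(2) order_trans by blast
qed

end
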